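(* Let $\pi$ be a (fixed) ordering pattern whose multiset of terms is $\{0^{\ell_0},1^{\ell_1},\ldots,r^{\ell_r}\}$ (that is, the value $j$ occurs exactly $\ell_j\ge1$ times in $\pi$, for $j=0,\dots,r$), where $\ell_j>1$ for at least one $j$. If $\pi$ has length $k$ and $d=k-(r+1)$, then for any positive constant $\alpha$, as $n\to\infty$, $$\mathbb{P}\big[\mathbf{C}_{n,p}\text{ contains the consecutive ordering pattern }\pi\big]\to\begin{cases}1,&\text{if } 1\gg q\gg n^{-1/d},\\ 1-e^{-\alpha^d/\lambda},&\text{if } q\sim\alpha n^{-1/d},\\ 0,&\text{if } n^{-1/d}\gg q,\end{cases}$$ where $\displaystyle\lambda=\prod_{j=0}^r\sum_{i=j}^r\ell_i$.
   Context: An $n$-composition is a sequence of $n$ nonnegative integers. For $p=p(n)\in[0,1)$ and $q=1-p$, the geometric random composition $\mathbf{C}_{n,p}$ is the random $n$-composition whose terms are independent, with $\mathbb{P}[\mathbf{C}_{n,p}(i)=j]=qp^j$ for every $j\ge0$ and $i\in\{1,\dots,n\}$. An ordering pattern of length $k$ is a sequence $\pi=\pi(1)\ldots\pi(k)$ of nonnegative integers whose set of values is an initial segment $\{0,1,\dots,r\}$ of the nonnegative integers. The consecutive ordering pattern $\pi$ occurs at position $\ell$ in a composition $C$ if $C(\ell),\ldots,C(\ell-1+k)$ have the same relative order as $\pi(1),\ldots,\pi(k)$; that is, for all $a,b\in\{1,\dots,k\}$, $C(\ell-1+a)<C(\ell-1+b)$ iff $\pi(a)<\pi(b)$, and $C(\ell-1+a)=C(\ell-1+b)$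 iff $\pi(a)=\pi(b)$. $C$ contains the pattern if it occurs at some position. For positive functions of $n$: $f\ll g$ (or $g\gg f$) means $\lim_{n\to\infty} f/g=0$, and $f\sim g$ means $\lim_{n\to\infty} f/g=1$. *)

theory Defs
  imports "HOL-Probability.Probability" "HOL-Library.Landau_Symbols" "HOL-Library.Multiset"
begin

definition ordering_pattern :: "nat list \<Rightarrow> bool" where
  "ordering_pattern \<pi> \<longleftrightarrow> (\<exists>r. set \<pi> = {0..r})"

text \<open>
  An \<open>n\<close>-composition is a function \<open>C :: nat \<Rightarrow> nat\<close> of which only the terms \<open>C 1, \<dots>, C n\<close>
  matter; in the random composition all other arguments have the default value \<open>0\<close>.
  The library's \<open>geometric_pmf q\<close> (number of failures before the first success)
  has mass \<open>q (1 - q)\<^sup>j\<close> at \<open>j \<ge> 0\<close>, so its parameter is \<open>q = 1 - p\<close>.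
\<close>
definition geom_composition :: "nat \<Rightarrow> real \<Rightarrow> (nat \<Rightarrow> nat) pmf" where
  "geom_composition n p = Pi_pmf {1..n} 0 (\<lambda>_. geometric_pmf (1 - p))"

lemma geom_composition_term:
  assumes "0 \<le> p" "p < 1" "i \<in> {1..n}"
  shows "measure_pmf.prob (geom_composition n p) {C. C i = j} = (1 - p) * p ^ j"
proof -
  have "measure_pmf.prob (geom_composition n p) {C. C i = j}
      = pmf (map_pmf (\<lambda>C. C i) (geom_composition n p)) j"
    by (simp add: pmf_map vimage_def)
  also have "map_pmf (\<lambda>C. C i) (geom_composition n p) = geometric_pmf (1 - p)"
    using assms(3) by (simp add: geom_composition_def Pi_pmf_component)
  finally show ?thesis
    using assms by simp
qed

lemma geom_composition_indep:
  "prob_space.indep_vars (measure_pmf (geom_composition n p)) (\<lambda>_. count_space UNIV)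
     (\<lambda>i C. C i) {1..n}"
  unfolding geom_composition_def by (rule indep_vars_Pi_pmf) simp

text \<open>
  Positions \<open>l\<close> and terms of compositions are counted from 1, list entries from 0; so
  \<open>C (l + a)\<close> is compared with the entry \<open>\<pi> ! a\<close>, for \<open>a = 0, \<dots>, length \<pi> - 1\<close>.
\<close>
definition occurs_at :: "nat list \<Rightarrow> nat \<Rightarrow> (nat \<Rightarrow> nat) \<Rightarrow> bool" where
  "occurs_at \<pi> l C \<longleftrightarrow>
     (\<forall>a<length \<pi>. \<forall>b<length \<pi>.
        (C (l + a) < C (l + b) \<longleftrightarrow> \<pi> ! a < \<pi> ! b) \<and>
        (C (l + a) = C (l + b) \<longleftrightarrow> \<pi> ! a = \<pi> ! b))"

definition contains_pattern :: "nat \<Rightarrow> (nat \<Rightarrow> nat) \<Rightarrow> nat list \<Rightarrow> bool" where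
  "contains_pattern n C \<pi> \<longleftrightarrow> (\<exists>l\<ge>1. l + length \<pi> \<le> n + 1 \<and> occurs_at \<pi> l C)"

end

theory Submission imports Defs begin

text \<open>
  Write \<open>q = 1 - p\<close>, let \<open>\<mu>\<close> be the probability of an occurrence at a given position, and call an
  entry of the pattern a repeat if its value has already appeared to its left; there are
  \<open>d = k - (r + 1)\<close> repeats. Three estimates give all cases.

  \<^item> An occurrence is determined by the gaps between its consecutive values. The value gap number
    \<open>i\<close> is added to every entry of the pattern that is at least \<open>i\<close>, say to \<open>M\<^sub>i\<close> of them, so under the
    geometric law the gaps contribute independent geometric series of ratios \<open>p ^ M\<^sub>i\<close>. This evaluates
    \<open>\<mu>\<close> in closed form (\<open>prob_occurs_at\<close>) and shows \<open>\<mu> \<sim> q ^ d / \<lambda>\<close> as \<open>q \<rightarrow> 0\<close>,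
    where \<open>\<lambda>\<close> is the product of the \<open>M\<^sub>i\<close>
    (\<open>occurrence_prob_asymp\<close>).

  \<^item> Occurrences do not clump. Reading from left to right, a term that has to equal an earlier one
    costs a factor of at most \<open>q\<close>, the largest atom of the geometric distribution
    (\<open>prob_Pi_pmf_repeats_le\<close>). One occurrence forces \<open>d\<close> such equalities. A second occurrence further to
    the right forces at least one more, because its last repeat lies to the right of every repeat
    of the first. So two given positions are both occurrences with probability at most \<open>q ^ (d + 1)\<close>
    (\<open>prob_occurs_at_twice_le\<close>).

  \<^item> Let \<open>f j\<close> be the probability that none of the positions \<open>1, \<dots>, j\<close> is an occurrence. An occurrence
    at \<open>j + 1\<close> is independent of the occurrences at positions up to \<open>j + 1 - k\<close>, and ignoring the fewer
    than \<open>k\<close> positions in between changes probabilities by \<open>O(q ^ (d + 1))\<close>. Therefore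
    \<open>f (j + 1) = (1 - \<mu>) f j + O(q ^ (d + 1))\<close>, and summing the errors gives
    \<open>f j = (1 - \<mu>) ^ j + O(j q ^ (d + 1))\<close> (\<open>avoids_approx\<close>).

  If \<open>n q ^ d\<close> tends to a finite \<open>\<tau>\<close> and \<open>q \<rightarrow> 0\<close>, the last error vanishes and
  \<open>(1 - \<mu>) ^ n \<rightarrow> exp (- \<tau> / \<lambda>)\<close>; here \<open>\<tau> = \<alpha> ^ d\<close> and \<open>\<tau> = 0\<close> are the second and the third case of the
  theorem. If \<open>n q ^ d \<rightarrow> \<infinity>\<close>, it suffices to look at about \<open>n / k\<close> disjoint windows, which are
  independent: all of them fail with probability at most \<open>(1 - \<mu>) ^ (n / k)\<close>, up to rounding of the
  exponent (\<open>avoids_le_power\<close>).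
\<close>

section \<open>Events in finite product distributions\<close>

lemma prob_pair_pmf_Times:
  "measure_pmf.prob (pair_pmf M N) (A \<times> B) = measure_pmf.prob M A * measure_pmf.prob N B"
proof -
  have "emeasure (pair_pmf M N) (A \<times> B)
      = (\<integral>\<^sup>+x. indicator (A \<times> B) x \<partial>pair_pmf M N)"
    by (simp add: nn_integral_indicator)
  also have "\<dots> = (\<integral>\<^sup>+a. \<integral>\<^sup>+b. indicator A a * indicator B b \<partial>N \<partial>M)"
    by (subst nn_integral_pair_pmf') (simp add: indicator_times)
  also have "\<dots> = emeasure M A * emeasure N B"
    by (simp add: nn_integral_cmult nn_integral_multc)
  finally have "ennreal (measure_pmf.prob (pair_pmf M N) (A \<times> B))
      = ennreal (measure_pmf.prob M A * measure_pmf.prob N B)"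
    by (simp add: measure_pmf.emeasure_eq_measure ennreal_mult)
  thus ?thesis by simp
qed

definition depends_only_on :: "'i set \<Rightarrow> ('i \<Rightarrow> 'a) set \<Rightarrow> bool" where
  "depends_only_on I E \<longleftrightarrow> (\<forall>C D. (\<forall>i\<in>I. C i = D i) \<longrightarrow> (C \<in> E \<longleftrightarrow> D \<in> E))"

lemma depends_only_onD:
  assumes "depends_only_on I E" "\<And>i. i \<in> I \<Longrightarrow> C i = D i"
  shows "C \<in> E \<longleftrightarrow> D \<in> E"
  using assms unfolding depends_only_on_def by blast

text \<open>
  The product over \<open>A\<close> is the product over \<open>I\<close> paired with the product over \<open>A - I\<close>; in this picture one
  event is a vertical cylinder and the other one a horizontal cylinder.
\<close>
lemma prob_Pi_pmf_Int_disjoint: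
  assumes "finite A" "I \<subseteq> A" "J \<subseteq> A" "I \<inter> J = {}"
    and E: "depends_only_on I E" and F: "depends_only_on J F"
  shows "measure_pmf.prob (Pi_pmf A d p) (E \<inter> F)
       = measure_pmf.prob (Pi_pmf A d p) E * measure_pmf.prob (Pi_pmf A d p) F"
proof -
  let ?P = "Pi_pmf A d p" and ?P1 = "Pi_pmf I d p" and ?P2 = "Pi_pmf (A - I) d p"
  let ?h = "\<lambda>(f, g) x. if x \<in> I then f x else g x"
  have fin: "finite I" "finite (A - I)"
    using assms(1,2) finite_subset by auto
  have "A = I \<union> (A - I)" using assms(2) by auto
  hence P: "?P = map_pmf ?h (pair_pmf ?P1 ?P2)"
    using Pi_pmf_union[of I "A - I" d p] fin by auto
  have 1: "?h fg \<in> E \<longleftrightarrow> fst fg \<in> E" for fg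
    by (rule depends_only_onD[OF E]) (auto simp: split_beta)
  have 2: "?h fg \<in> F \<longleftrightarrow> snd fg \<in> F" for fg
    using assms(4) by (intro depends_only_onD[OF F]) (auto simp: split_beta)
  have "?h -` (E \<inter> F) = E \<times> F" "?h -` E = E \<times> UNIV" "?h -` F = UNIV \<times> F"
    using 1 2 by (auto simp: vimage_def)
  thus ?thesis
    by (simp add: P prob_pair_pmf_Times)
qed

text \<open>
  Conditioning on the second component \<open>f\<close>, the first one has to hit the single value \<open>h f\<close>.
\<close>
lemma prob_pair_graph_le:
  assumes c: "\<And>y. pmf M y \<le> c" and "c \<ge> 0"
  shows "measure_pmf.prob (pair_pmf M N) {(y, f). f \<in> E \<and> y = h f} \<le> c * measure_pmf.prob N E"
proof -
  let ?S = "{(y, f). f \<in> E \<and> y = h f}"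
  have "emeasure (pair_pmf M N) ?S = emeasure (pair_pmf N M) ((\<lambda>(f, y). (y, f)) -` ?S)"
    by (subst pair_commute_pmf) simp
  also have "\<dots> = (\<integral>\<^sup>+x. indicator ((\<lambda>(f, y). (y, f)) -` ?S) x \<partial>pair_pmf N M)"
    by (simp add: nn_integral_indicator)
  also have "\<dots> = (\<integral>\<^sup>+f. \<integral>\<^sup>+y. indicator E f * indicator {h f} y \<partial>M \<partial>N)"
    by (subst nn_integral_pair_pmf') (auto intro!: nn_integral_cong simp: indicator_def)
  also have "\<dots> = (\<integral>\<^sup>+f. indicator E f * ennreal (pmf M (h f)) \<partial>N)"
    by (simp add: nn_integral_cmult emeasure_pmf_single)
  also have "\<dots> \<le> (\<integral>\<^sup>+f. indicator E f * ennreal c \<partial>N)"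
    by (intro nn_integral_mono mult_left_mono) (auto intro: ennreal_leI c)
  also have "\<dots> = ennreal (c * measure_pmf.prob N E)"
    using \<open>c \<ge> 0\<close>
    by (subst mult.commute)
       (simp add: nn_integral_cmult measure_pmf.emeasure_eq_measure ennreal_mult)
  finally show ?thesis
    using \<open>c \<ge> 0\<close> by (simp add: measure_pmf.emeasure_eq_measure)
qed

text \<open>
  Each coordinate in \<open>X\<close> copies some coordinate to its left. Uncover the largest coordinate of \<open>X\<close>
  last: the value that it must copy is then known and is hit with probability at most \<open>c\<close>.
  The induction removes this coordinate from the index set, which is why \<open>I\<close> is arbitrary.
\<close>
lemma prob_Pi_pmf_repeats_le:
  fixes E :: "(nat \<Rightarrow> 'a) set"
  assumes "finite I" "X \<subseteq> I" "\<And>i y. pmf (p i) y \<le> c" "c \<ge> 0"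
    and "\<And>x. x \<in> X \<Longrightarrow> \<exists>y<x. \<forall>C\<in>E. C x = C y"
  shows "measure_pmf.prob (Pi_pmf I d p) E \<le> c ^ card X"
proof -
  have "\<forall>x\<in>X. \<exists>y. y < x \<and> (\<forall>C\<in>E. C x = C y)"
    using assms(5) by blast
  then obtain f where f: "\<And>x. x \<in> X \<Longrightarrow> f x < x" "\<And>x C. x \<in> X \<Longrightarrow> C \<in> E \<Longrightarrow> C x = C (f x)"
    by metis
  have "finite X" using assms(1,2) finite_subset by blast
  hence "measure_pmf.prob (Pi_pmf I d p) {C. \<forall>x\<in>X. C x = C (f x)} \<le> c ^ card X"
    using assms(1,2) f(1)
  proof (induction X arbitrary: I rule: finite_linorder_max_induct)
    case (insert b X I)
    let ?E = "{C. \<forall>x\<in>X. C x = C (f x)}"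
    let ?J = "I - {b}"
    have b: "b \<notin> X" using insert.hyps by auto
    have I: "I = insert b ?J" using insert.prems by auto
    have fin: "finite ?J" using insert.prems by simp
    have ne: "f b \<noteq> b" "\<And>x. x \<in> X \<Longrightarrow> f x \<noteq> b" "\<And>x. x \<in> X \<Longrightarrow> x \<noteq> b"
      using insert.prems(3) insert.hyps(2) by (force dest: less_trans)+
    have eq: "(\<lambda>(y, C). C(b := y)) -` {C. \<forall>x\<in>insert b X. C x = C (f x)}
        = {(y, C). C \<in> ?E \<and> y = C (f b)}"
      using ne by auto
    have P: "Pi_pmf I d p = map_pmf (\<lambda>(y, C). C(b := y)) (pair_pmf (p b) (Pi_pmf ?J d p))"
      by (subst I, rule Pi_pmf_insert) (use fin in auto)
    have "measure_pmf.prob (Pi_pmf I d p) {C. \<forall>x\<in>insert b X. C x = C (f x)}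
        = measure_pmf.prob (pair_pmf (p b) (Pi_pmf ?J d p)) {(y, C). C \<in> ?E \<and> y = C (f b)}"
      unfolding P measure_map_pmf eq ..
    also have "\<dots> \<le> c * measure_pmf.prob (Pi_pmf ?J d p) ?E"
      by (rule prob_pair_graph_le) (use assms(3,4) in auto)
    also have "\<dots> \<le> c * c ^ card X"
      using insert.prems ne b by (intro mult_left_mono insert.IH assms(4)) auto
    also have "\<dots> = c ^ card (insert b X)"
      using insert.hyps b by simp
    finally show ?case .
  qed simp
  moreover have "measure_pmf.prob (Pi_pmf I d p) E
      \<le> measure_pmf.prob (Pi_pmf I d p) {C. \<forall>x\<in>X. C x = C (f x)}"
    using f(2) by (intro measure_pmf.finite_measure_mono) auto
  ultimately show ?thesis
    by linarith
qed

section \<open>Repeated values and overlapping occurrences\<close>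

lemma occurs_at_eq:
  assumes "occurs_at \<pi> l C" "x < length \<pi>" "y < length \<pi>" "\<pi> ! x = \<pi> ! y"
  shows "C (l + x) = C (l + y)"
  using assms unfolding occurs_at_def by blast

lemma depends_only_on_occurs_at:
  "depends_only_on {l..<l + length \<pi>} {C. occurs_at \<pi> l C}"
  unfolding depends_only_on_def occurs_at_def by auto

definition repeats :: "'a list \<Rightarrow> nat set" where
  "repeats xs = {x. x < length xs \<and> (\<exists>y<x. xs ! y = xs ! x)}"

lemma finite_repeats [simp]: "finite (repeats xs)"
  unfolding repeats_def by auto

text \<open>
  The first appearances of the values are in bijection with the values.
\<close>
lemma card_repeats: "card (repeats xs) = length xs - card (set xs)"
proof -
  let ?F = "{..<length xs} - repeats xs"
  have "(!) xs ` ?F = set xs"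
  proof (intro equalityI subsetI)
    fix v assume "v \<in> set xs"
    then have ex: "\<exists>a. a < length xs \<and> xs ! a = v" by (simp add: in_set_conv_nth)
    define b where "b = (LEAST a. a < length xs \<and> xs ! a = v)"
    have b: "b < length xs" "xs ! b = v"
      unfolding b_def using LeastI_ex[OF ex] by auto
    have "b \<notin> repeats xs"
      using b not_less_Least[where P = "\<lambda>a. a < length xs \<and> xs ! a = v"]
      unfolding repeats_def b_def[symmetric] by force
    thus "v \<in> (!) xs ` ?F" using b by auto
  qed auto
  moreover have "inj_on ((!) xs) ?F"
  proof (rule inj_onI)
    fix x y assume *: "x \<in> ?F" "y \<in> ?F" "xs ! x = xs ! y"
    show "x = y"
      using * unfolding repeats_def by (cases x y rule: linorder_cases) auto
  qed
  ultimately have "card (set xs) = card ?F"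
    by (metis card_image)
  also have "\<dots> = length xs - card (repeats xs)"
    by (subst card_Diff_subset) (auto simp: repeats_def)
  finally have "card (set xs) = length xs - card (repeats xs)" .
  moreover have "card (repeats xs) \<le> card {..<length xs}"
    by (intro card_mono) (auto simp: repeats_def)
  ultimately show ?thesis by simp
qed

lemma pmf_geometric_le:
  assumes "0 \<le> p" "p < (1::real)"
  shows "pmf (geometric_pmf (1 - p)) y \<le> 1 - p"
  using assms power_le_one[of p y] by (simp add: mult_left_le_one_le)

lemma prob_occurs_at_le:
  assumes "0 \<le> p" "p < 1" "1 \<le> l" "l + length \<pi> \<le> n + 1"
  shows "measure_pmf.prob (geom_composition n p) {C. occurs_at \<pi> l C}
       \<le> (1 - p) ^ card (repeats \<pi>)"
proof -
  have "measure_pmf.prob (geom_composition n p) {C. occurs_at \<pi> l C}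
      \<le> (1 - p) ^ card ((+) l ` repeats \<pi>)"
    unfolding geom_composition_def
  proof (rule prob_Pi_pmf_repeats_le)
    show "(+) l ` repeats \<pi> \<subseteq> {1..n}"
      using assms(3,4) by (auto simp: repeats_def)
    fix x assume "x \<in> (+) l ` repeats \<pi>"
    then obtain a b where "x = l + a" "a < length \<pi>" "b < a" "\<pi> ! b = \<pi> ! a"
      unfolding repeats_def by auto
    thus "\<exists>y<x. \<forall>C\<in>{C. occurs_at \<pi> l C}. C x = C y"
      by (intro exI[of _ "l + b"]) (auto intro: occurs_at_eq)
  qed (use assms pmf_geometric_le in auto)
  thus ?thesis by (simp add: card_image)
qed

text \<open>
  Besides the repeats of the left occurrence, the last repeat \<open>b\<close> of the right occurrence copies an
  earlier term. Its place \<open>l' + b\<close> exceeds \<open>l + x\<close> for every repeat \<open>x\<close>, whether or not the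
  two windows overlap, so this equality is not among those already counted.
\<close>
lemma prob_occurs_at_twice_le:
  assumes "0 \<le> p" "p < 1" "1 \<le> l" "l < l'" "l' + length \<pi> \<le> n + 1" "repeats \<pi> \<noteq> {}"
  shows "measure_pmf.prob (geom_composition n p) {C. occurs_at \<pi> l C \<and> occurs_at \<pi> l' C}
       \<le> (1 - p) ^ Suc (card (repeats \<pi>))"
proof -
  define b where "b = Max (repeats \<pi>)"
  have b: "b \<in> repeats \<pi>" "\<And>x. x \<in> repeats \<pi> \<Longrightarrow> x \<le> b"
    unfolding b_def using assms(6) by auto
  let ?X = "insert (l' + b) ((+) l ` repeats \<pi>)"
  let ?E = "{C. occurs_at \<pi> l C \<and> occurs_at \<pi> l' C}"
  have new: "l' + b \<notin> (+) l ` repeats \<pi>"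
    using b(2) assms(4) by force
  have "measure_pmf.prob (geom_composition n p) ?E \<le> (1 - p) ^ card ?X"
    unfolding geom_composition_def
  proof (rule prob_Pi_pmf_repeats_le)
    show "?X \<subseteq> {1..n}"
      using assms(3-5) b(1) by (auto simp: repeats_def)
    fix x assume "x \<in> ?X"
    then obtain s a where s: "s \<in> {l, l'}" "x = s + a" "a \<in> repeats \<pi>"
      using b(1) by auto
    then obtain c where c: "a < length \<pi>" "c < a" "\<pi> ! c = \<pi> ! a"
      unfolding repeats_def by auto
    show "\<exists>y<x. \<forall>C\<in>?E. C x = C y"
      using s(1,2) c by (intro exI[of _ "s + c"]) (auto intro: occurs_at_eq)
  qed (use assms pmf_geometric_le in auto)
  also have "card ?X = Suc (card (repeats \<pi>))"
    using new by (simp add: card_image)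
  finally show ?thesis .
qed

section \<open>The probability of an occurrence\<close>

text \<open>
  The value number \<open>j\<close> of a strictly increasing sequence of naturals whose first term is \<open>g 0\<close> and
  whose consecutive differences are \<open>g i + 1\<close>. Subtracting the one makes every choice of naturals
  \<open>g\<close> admissible.
\<close>
definition gap_partial :: "(nat \<Rightarrow> nat) \<Rightarrow> nat \<Rightarrow> nat" where
  "gap_partial g j = (\<Sum>i\<le>j. g i) + j"

lemma strict_mono_gap_partial: "strict_mono (gap_partial g)"
  by (rule strict_mono_Suc_iff[THEN iffD2]) (simp add: gap_partial_def)

lemma gap_partial_inj:
  assumes "\<And>j. j \<le> r \<Longrightarrow> gap_partial g j = gap_partial g' j" "i \<le> r"
  shows "g i = g' i"
  using assms(1)[of i] assms(1)[of "i - 1"] assms(2) by (cases i) (auto simp: gap_partial_def)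

lemma gap_partial_surj:
  assumes "\<And>i j. i < j \<Longrightarrow> j \<le> r \<Longrightarrow> c i < (c j :: nat)"
  obtains g where "\<And>i. i > r \<Longrightarrow> g i = 0" "\<And>j. j \<le> r \<Longrightarrow> gap_partial g j = c j"
proof
  let ?g = "\<lambda>i. if i > r then 0 else if i = 0 then c 0 else c i - Suc (c (i - 1))"
  show "?g i = 0" if "i > r" for i using that by simp
  show "gap_partial ?g j = c j" if "j \<le> r" for j
    using that
  proof (induction j)
    case (Suc j)
    have "c j < c (Suc j)" using assms Suc.prems by simp
    thus ?case using Suc by (simp add: gap_partial_def)
  qed (simp add: gap_partial_def)
qed

definition level_count :: "nat list \<Rightarrow> nat \<Rightarrow> nat" where
  "level_count \<pi> i = card {a. a < length \<pi> \<and> i \<le> \<pi> ! a}"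

text \<open>
  The gap \<open>g i\<close> enters exactly the entries that are at least \<open>i\<close>. The second summand collects the
  increments by one, which give \<open>\<pi> ! a\<close> at the entry \<open>a\<close>.
\<close>
lemma sum_gap_partial:
  assumes "set \<pi> = {0..r}"
  shows "(\<Sum>a<length \<pi>. gap_partial g (\<pi> ! a)) = (\<Sum>i\<le>r. level_count \<pi> i * g i) + sum_list \<pi>"
proof -
  have "(\<Sum>a<length \<pi>. \<Sum>i\<le>\<pi> ! a. g i) = (\<Sum>a<length \<pi>. \<Sum>i\<le>r. if i \<le> \<pi> ! a then g i else 0)"
  proof (rule sum.cong[OF refl])
    fix a assume "a \<in> {..<length \<pi>}"
    hence "\<pi> ! a \<le> r" using assms by (metis atLeastAtMost_iff lessThan_iff nth_mem)
    hence "{..r} \<inter> {i. i \<le> \<pi> ! a} = {..\<pi> ! a}" by auto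
    thus "sum g {..\<pi> ! a} = (\<Sum>i\<le>r. if i \<le> \<pi> ! a then g i else 0)"
      by (simp add: sum.If_cases)
  qed
  also have "\<dots> = (\<Sum>i\<le>r. \<Sum>a<length \<pi>. if i \<le> \<pi> ! a then g i else 0)"
    by (rule sum.swap)
  also have "\<dots> = (\<Sum>i\<le>r. level_count \<pi> i * g i)"
    by (rule sum.cong[OF refl]) (simp add: sum.If_cases level_count_def lessThan_def Collect_conj_eq)
  finally show ?thesis
    by (simp add: gap_partial_def sum.distrib sum_list_sum_nth atLeast0LessThan)
qed

text \<open>
  The composition restricted to the window is the pattern with its values \<open>0, \<dots>, r\<close> replaced by an
  arbitrary strictly increasing sequence, and such sequences correspond to their gaps.
\<close>
lemma bij_betw_gaps_occurrences:
  assumes \<pi>: "set \<pi> = {0..r}"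
  shows "bij_betw (\<lambda>g x. if x \<in> {l..<l + length \<pi>} then gap_partial g (\<pi> ! (x - l)) else 0)
    {g. \<forall>i>r. g i = 0}
    {C. occurs_at \<pi> l C \<and> (\<forall>x. x \<notin> {l..<l + length \<pi>} \<longrightarrow> C x = 0)}"
    (is "bij_betw ?h ?G ?E")
proof (rule bij_betw_imageI)
  have pos: "\<exists>a<length \<pi>. \<pi> ! a = j" if "j \<le> r" for j
    using \<pi> that by (metis atLeastAtMost_iff in_set_conv_nth le0)
  have val: "\<pi> ! a \<le> r" if "a < length \<pi>" for a
    using \<pi> that by (metis atLeastAtMost_iff nth_mem)
  show "inj_on ?h ?G"
  proof (rule inj_onI, rule ext)
    fix g g' i assume g: "g \<in> ?G" "g' \<in> ?G" and eq: "?h g = ?h g'"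
    have "gap_partial g j = gap_partial g' j" if "j \<le> r" for j
    proof -
      from pos[OF that] obtain a where "a < length \<pi>" "\<pi> ! a = j" by blast
      thus ?thesis using fun_cong[OF eq, of "l + a"] by simp
    qed
    thus "g i = g' i"
      using gap_partial_inj[of r g g' i] g by (cases "i \<le> r") auto
  qed
  show "?h ` ?G = ?E"
  proof (intro equalityI subsetI)
    fix C assume "C \<in> ?h ` ?G"
    thus "C \<in> ?E"
      by (auto simp: occurs_at_def strict_mono_less[OF strict_mono_gap_partial]
                     strict_mono_eq[OF strict_mono_gap_partial])
  next
    fix C assume C: "C \<in> ?E"
    obtain s where s: "\<And>j. j \<le> r \<Longrightarrow> s j < length \<pi> \<and> \<pi> ! s j = j"
      using pos by metis
    have "C (l + s i) < C (l + s j)" if "i < j" "j \<le> r" for i j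
      using C s[of i] s[of j] that unfolding occurs_at_def by force
    from gap_partial_surj[of r "\<lambda>j. C (l + s j)", OF this]
    obtain g where g: "\<And>i. i > r \<Longrightarrow> g i = 0" "\<And>j. j \<le> r \<Longrightarrow> gap_partial g j = C (l + s j)"
      by metis
    have "?h g x = C x" for x
    proof (cases "x \<in> {l..<l + length \<pi>}")
      case True
      then obtain a where a: "x = l + a" "a < length \<pi>"
        by (metis add_diff_inverse_nat atLeastLessThan_iff nat_add_left_cancel_less not_less)
      have "C (l + s (\<pi> ! a)) = C (l + a)"
        using s[OF val[OF a(2)]] a C by (intro occurs_at_eq) auto
      thus ?thesis using a g(2)[OF val[OF a(2)]] by simp
    qed (use C in auto)
    thus "C \<in> ?h ` ?G"
      using g(1) by (intro image_eqI[of _ _ g]) auto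
  qed
qed

lemma level_count_pos:
  assumes "set \<pi> = {0..r}" "i \<le> r"
  shows "level_count \<pi> i > 0"
proof -
  have "r \<in> set \<pi>" using assms by simp
  then obtain a where "a < length \<pi>" "\<pi> ! a = r" by (metis in_set_conv_nth)
  thus ?thesis using assms(2) unfolding level_count_def by (subst card_gt_0_iff) auto
qed

text \<open>
  The closed form of \<open>\<mu>\<close>. The \<open>r + 1\<close> geometric series contribute \<open>1 / (1 - p ^ M\<^sub>i)\<close> each; splitting off
  the factor \<open>1 - p\<close> from every denominator lowers the exponent of \<open>1 - p\<close> from \<open>k\<close> to
  \<open>k - (r + 1)\<close> and leaves a quotient that is continuous at \<open>p = 1\<close>.
\<close>
definition occurrence_prob :: "nat list \<Rightarrow> nat \<Rightarrow> real \<Rightarrow> real" where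
  "occurrence_prob \<pi> r p =
     (1 - p) ^ (length \<pi> - (r + 1)) * p ^ sum_list \<pi> / (\<Prod>i\<le>r. \<Sum>j<level_count \<pi> i. p ^ j)"

text \<open>
  Under the bijection with gap sequences, the mass of an occurrence is \<open>K\<close> times the mass of its
  gaps in a product of geometric distributions with ratios \<open>p ^ M\<^sub>i\<close>. The latter masses sum to \<open>1\<close>, so
  the probability is \<open>K\<close>, without any summation of series.
\<close>
lemma prob_occurs_at_window:
  assumes \<pi>: "set \<pi> = {0..r}" and p: "0 \<le> p" "p < 1"
  shows "measure_pmf.prob (Pi_pmf {l..<l + length \<pi>} 0 (\<lambda>_. geometric_pmf (1 - p)))
           {C. occurs_at \<pi> l C} = occurrence_prob \<pi> r p"
proof -
  define W where "W = {l..<l + length \<pi>}"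
  let ?M = "level_count \<pi>"
  let ?h = "\<lambda>g x. if x \<in> W then gap_partial g (\<pi> ! (x - l)) else 0"
  let ?P = "Pi_pmf W 0 (\<lambda>_. geometric_pmf (1 - p))"
  let ?Q = "Pi_pmf {..r} 0 (\<lambda>i. geometric_pmf (1 - p ^ ?M i))"
  let ?G = "{g :: nat \<Rightarrow> nat. \<forall>i>r. g i = 0}"
  let ?E = "{C. occurs_at \<pi> l C \<and> (\<forall>x. x \<notin> W \<longrightarrow> C x = 0)}"
  define K where "K = (1 - p) ^ length \<pi> * p ^ sum_list \<pi> / (\<Prod>i\<le>r. 1 - p ^ ?M i)"
  have Mpos: "?M i > 0" if "i \<le> r" for i using level_count_pos[OF \<pi> that] .
  have pM: "p ^ ?M i < 1" if "i \<le> r" for i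
    using p Mpos[OF that] by (simp add: power_Suc_less_one power_less_one_iff)
  have prod_pos: "(\<Prod>i\<le>r. 1 - p ^ ?M i) > 0"
    using pM by (intro prod_pos) auto
  have K: "K \<ge> 0" unfolding K_def using p prod_pos by auto
  have pmf_Q: "pmf ?Q g = (\<Prod>i\<le>r. p ^ (?M i * g i)) * (\<Prod>i\<le>r. 1 - p ^ ?M i)" if "g \<in> ?G" for g
    using that p pM
    by (subst pmf_Pi')
       (auto simp: prod.distrib[symmetric] power_mult power_le_one intro!: prod.cong pmf_geometric)
  have pmf_P: "pmf ?P (?h g) = K * pmf ?Q g" if g: "g \<in> ?G" for g
  proof -
    have "pmf ?P (?h g) = (\<Prod>x\<in>W. (1 - p) * p ^ ?h g x)"
      using p by (subst pmf_Pi') (auto simp: W_def intro!: prod.cong)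
    also have "\<dots> = (\<Prod>a<length \<pi>. (1 - p) * p ^ gap_partial g (\<pi> ! a))"
      by (rule prod.reindex_bij_witness[of _ "\<lambda>a. l + a" "\<lambda>x. x - l"]) (auto simp: W_def)
    also have "\<dots> = (1 - p) ^ length \<pi> * p ^ (\<Sum>a<length \<pi>. gap_partial g (\<pi> ! a))"
      by (simp add: prod.distrib power_sum)
    also have "\<dots> = (1 - p) ^ length \<pi> * p ^ sum_list \<pi> * (\<Prod>i\<le>r. p ^ (?M i * g i))"
      by (simp add: sum_gap_partial[OF \<pi>] power_add power_sum)
    also have "\<dots> = K * pmf ?Q g"
      unfolding pmf_Q[OF g] K_def using less_imp_neq[OF prod_pos]
      by (metis (no_types, lifting) mult.assoc mult.commute nonzero_eq_divide_eq)
    finally show ?thesis .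
  qed
  have "AE C in ?P. \<forall>x. x \<notin> W \<longrightarrow> C x = 0"
    using set_Pi_pmf_subset[of W 0] by (auto simp: AE_measure_pmf_iff W_def)
  hence "AE C in ?P. C \<in> {C. occurs_at \<pi> l C} \<longleftrightarrow> C \<in> ?E"
    by eventually_elim auto
  hence "emeasure ?P {C. occurs_at \<pi> l C} = emeasure ?P ?E"
    by (rule emeasure_eq_AE) auto
  also have "\<dots> = (\<integral>\<^sup>+C. pmf ?P C \<partial>count_space ?E)"
    by (simp add: nn_integral_pmf)
  also have "\<dots> = (\<integral>\<^sup>+g. pmf ?P (?h g) \<partial>count_space ?G)"
    using bij_betw_gaps_occurrences[OF \<pi>, of l] unfolding W_def[symmetric]
    by (rule nn_integral_bij_count_space[symmetric])
  also have "\<dots> = (\<integral>\<^sup>+g. ennreal K * ennreal (pmf ?Q g) \<partial>count_space ?G)"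
    using K by (intro nn_integral_cong) (simp add: pmf_P ennreal_mult)
  also have "\<dots> = ennreal K * emeasure ?Q ?G"
    by (simp add: nn_integral_cmult nn_integral_pmf)
  also have "emeasure ?Q ?G = 1"
    using set_Pi_pmf_subset[of "{..r}" 0 "\<lambda>i. geometric_pmf (1 - p ^ ?M i)"]
    by (intro measure_pmf.emeasure_eq_1_AE) (auto simp: AE_measure_pmf_iff)
  finally have "measure_pmf.prob ?P {C. occurs_at \<pi> l C} = K"
    using K by (simp add: measure_pmf.emeasure_eq_measure)
  also have "K = occurrence_prob \<pi> r p"
  proof -
    have "r + 1 \<le> length \<pi>"
      using card_length[of \<pi>] \<pi> by simp
    hence "(1 - p) ^ length \<pi> = (1 - p) ^ (length \<pi> - (r + 1)) * (1 - p) ^ (r + 1)"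
      by (metis le_add_diff_inverse2 power_add)
    moreover have "(\<Prod>i\<le>r. 1 - p ^ ?M i) = (1 - p) ^ (r + 1) * (\<Prod>i\<le>r. \<Sum>j<?M i. p ^ j)"
      unfolding one_diff_power_eq prod.distrib by simp
    moreover have "(1 - p) ^ (r + 1) \<noteq> 0"
      using p by simp
    moreover have "a * c * b / (c * e) = a * b / e" if "c \<noteq> 0" for a b c e :: real
      using that by simp
    ultimately show ?thesis
      unfolding K_def occurrence_prob_def by presburger
  qed
  finally show ?thesis unfolding W_def .
qed

lemma prob_occurs_at:
  assumes \<pi>: "set \<pi> = {0..r}" and p: "0 \<le> p" "p < 1" and l: "1 \<le> l" "l + length \<pi> \<le> n + 1"
  shows "measure_pmf.prob (geom_composition n p) {C. occurs_at \<pi> l C} = occurrence_prob \<pi> r p"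
proof -
  let ?W = "{l..<l + length \<pi>}"
  let ?r = "\<lambda>C x. if x \<in> ?W then C x else 0"
  have "?r C \<in> {C. occurs_at \<pi> l C} \<longleftrightarrow> C \<in> {C. occurs_at \<pi> l C}" for C
    by (rule depends_only_onD[OF depends_only_on_occurs_at]) simp
  hence eq: "?r -` {C. occurs_at \<pi> l C} = {C. occurs_at \<pi> l C}"
    by (auto simp only: vimage_def)
  have "?W \<subseteq> {1..n}" using l by auto
  hence "Pi_pmf ?W 0 (\<lambda>_. geometric_pmf (1 - p)) = map_pmf ?r (geom_composition n p)"
    unfolding geom_composition_def by (intro Pi_pmf_subset) auto
  thus ?thesis
    using prob_occurs_at_window[OF \<pi> p, of l] eq by simp
qed

lemma occurrence_prob_asymp:
  assumes \<pi>: "set \<pi> = {0..r}" and p: "p \<longlonglongrightarrow> 1" "\<And>n. p n < 1"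
  shows "(\<lambda>n. occurrence_prob \<pi> r (p n) / (1 - p n) ^ (length \<pi> - (r + 1)))
           \<longlonglongrightarrow> 1 / (\<Prod>i\<le>r. real (level_count \<pi> i))"
proof -
  have "(\<Prod>i\<le>r. \<Sum>j<level_count \<pi> i. (1::real) ^ j) = (\<Prod>i\<le>r. real (level_count \<pi> i))"
    by simp
  moreover have "(\<Prod>i\<le>r. real (level_count \<pi> i)) \<noteq> 0"
    using level_count_pos[OF \<pi>] by (auto simp: less_imp_neq[symmetric])
  ultimately have "(\<lambda>n. p n ^ sum_list \<pi> / (\<Prod>i\<le>r. \<Sum>j<level_count \<pi> i. p n ^ j))
      \<longlonglongrightarrow> 1 / (\<Prod>i\<le>r. real (level_count \<pi> i))"
    using p(1) by (auto intro!: tendsto_eq_intros dest!: level_count_pos[OF \<pi>])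
  moreover have "1 - p n \<noteq> 0" for n using p(2)[of n] by simp
  ultimately show ?thesis by (simp add: occurrence_prob_def)
qed

section \<open>Compositions without occurrences\<close>

text \<open>
  The bound \<open>j\<close> limits the starting positions, so this event involves the terms up to
  \<open>j + length \<pi> - 1\<close>. All of these events live in the same probability space.
\<close>
definition avoids_upto :: "nat list \<Rightarrow> nat \<Rightarrow> (nat \<Rightarrow> nat) set" where
  "avoids_upto \<pi> j = {C. \<forall>l\<in>{1..j}. \<not> occurs_at \<pi> l C}"

lemma depends_only_on_avoids_upto:
  "depends_only_on {1..<j + length \<pi>} (avoids_upto \<pi> j)"
  unfolding depends_only_on_def
proof (intro allI impI)
  fix C D :: "nat \<Rightarrow> nat"
  assume eq: "\<forall>i\<in>{1..<j + length \<pi>}. C i = D i"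
  have "C \<in> {C. occurs_at \<pi> l C} \<longleftrightarrow> D \<in> {C. occurs_at \<pi> l C}" if "l \<in> {1..j}" for l
    by (rule depends_only_onD[OF depends_only_on_occurs_at]) (use eq that in auto)
  thus "C \<in> avoids_upto \<pi> j \<longleftrightarrow> D \<in> avoids_upto \<pi> j"
    by (simp add: avoids_upto_def)
qed

lemma prob_avoids_Int_occurs:
  assumes "i + length \<pi> \<le> l" "1 \<le> l" "l + length \<pi> \<le> n + 1"
  shows "measure_pmf.prob (geom_composition n p) (avoids_upto \<pi> i \<inter> {C. occurs_at \<pi> l C})
       = measure_pmf.prob (geom_composition n p) (avoids_upto \<pi> i)
         * measure_pmf.prob (geom_composition n p) {C. occurs_at \<pi> l C}"
  unfolding geom_composition_def
  by (rule prob_Pi_pmf_Int_disjoint[OF _ _ _ _ depends_only_on_avoids_upto depends_only_on_occurs_at])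
     (use assms in auto)

lemma prob_union_le:
  assumes "finite I" "\<And>i. i \<in> I \<Longrightarrow> measure_pmf.prob M (A i) \<le> c" "E \<subseteq> (\<Union>i\<in>I. A i)"
  shows "measure_pmf.prob M E \<le> real (card I) * c"
proof -
  have "measure_pmf.prob M E \<le> measure_pmf.prob M (\<Union>i\<in>I. A i)"
    using assms(3) by (intro measure_pmf.finite_measure_mono) auto
  also have "\<dots> \<le> (\<Sum>i\<in>I. measure_pmf.prob M (A i))"
    using assms(1) by (intro measure_pmf.finite_measure_subadditive_finite) auto
  also have "\<dots> \<le> real (card I) * c"
    using assms(2) by (intro sum_bounded_above) auto
  finally show ?thesis .
qed

text \<open>
  Exactly, \<open>f (j + 1) = f j - P (U j \<inter> A (j + 1))\<close>, where \<open>U j\<close> is avoidance up to \<open>j\<close> and \<open>A l\<close> an occurrence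
  at \<open>l\<close>. Replacing \<open>U j\<close> by \<open>U i\<close> with \<open>i = j + 1 - k\<close> makes the two events independent and yields
  \<open>\<mu> f i\<close>. The replacement costs an occurrence at one of the positions in between: together with
  \<open>A (j + 1)\<close> this is a double occurrence, and for the change from \<open>\<mu> f i\<close> to \<open>\<mu> f j\<close> it costs at most
  \<open>k \<mu>\<^sup>2 \<le> k q ^ (2 d) \<le> k q ^ (d + 1)\<close>. The two errors have opposite signs, so they are not added.
\<close>
lemma avoids_step:
  fixes \<pi> :: "nat list" and n j r :: nat and p :: real
  defines "f \<equiv> \<lambda>j. measure_pmf.prob (geom_composition n p) (avoids_upto \<pi> j)"
    and "\<mu> \<equiv> occurrence_prob \<pi> r p" and "d \<equiv> card (repeats \<pi>)"
  assumes \<pi>: "set \<pi> = {0..r}" "repeats \<pi> \<noteq> {}" and p: "0 \<le> p" "p < 1"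
    and j: "j + length \<pi> \<le> n"
  shows "\<bar>f (Suc j) - (1 - \<mu>) * f j\<bar> \<le> length \<pi> * (1 - p) ^ Suc d"
proof -
  let ?k = "length \<pi>" and ?q = "1 - p"
  let ?P = "measure_pmf.prob (geom_composition n p)"
  let ?A = "\<lambda>l. {C. occurs_at \<pi> l C}" and ?U = "avoids_upto \<pi>"
  \<comment> \<open>For \<open>j + 1 < k\<close> the difference is \<open>0\<close>, and \<open>U 0\<close> is the sure event.\<close>
  define i where "i = j + 1 - ?k"
  have "?k > 0" using \<pi>(1) by auto
  hence i: "i \<le> j" "card {i<..j} \<le> ?k" unfolding i_def card_greaterThanAtMost by arith+
  have d: "d \<ge> 1" using \<pi>(2) by (simp add: d_def Suc_le_eq card_gt_0_iff)
  have \<mu>: "?P (?A l) = \<mu>" if "1 \<le> l" "l \<le> Suc j" for l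
    unfolding \<mu>_def using that j by (intro prob_occurs_at \<pi> p) auto
  have \<mu>_le: "0 \<le> \<mu>" "\<mu> \<le> ?q ^ d"
    using \<mu>[of 1] prob_occurs_at_le[of p 1 \<pi> n] p j unfolding d_def by (auto simp flip: \<mu>)
  have step: "f (Suc j) = f j - ?P (?U j \<inter> ?A (Suc j))"
  proof -
    have "?U (Suc j) = ?U j - ?U j \<inter> ?A (Suc j)"
      by (auto simp: avoids_upto_def atLeastAtMostSuc_conv)
    thus ?thesis unfolding f_def by (simp add: measure_pmf.finite_measure_Diff)
  qed
  have window: "?P (?U i) - ?P (?U j) \<le> ?k * \<mu>"
  proof -
    have "?P (?U i) - ?P (?U j) = ?P (?U i - ?U j)"
      using i by (subst measure_pmf.finite_measure_Diff) (auto simp: avoids_upto_def)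
    also have "\<dots> \<le> card {i<..j} * \<mu>"
      by (rule prob_union_le[where A = ?A]) (auto simp: \<mu> avoids_upto_def not_le)
    also have "\<dots> \<le> ?k * \<mu>"
      using i \<mu>_le by (intro mult_right_mono) auto
    finally show ?thesis .
  qed
  have clump: "?P (?U i \<inter> ?A (Suc j)) - ?P (?U j \<inter> ?A (Suc j)) \<le> ?k * ?q ^ Suc d"
  proof -
    have "?P (?U i \<inter> ?A (Suc j)) - ?P (?U j \<inter> ?A (Suc j))
        = ?P (?U i \<inter> ?A (Suc j) - ?U j \<inter> ?A (Suc j))"
      using i by (subst measure_pmf.finite_measure_Diff) (auto simp: avoids_upto_def)
    also have "\<dots> \<le> card {i<..j} * ?q ^ Suc d"
    proof (rule prob_union_le[where A = "\<lambda>l. {C. occurs_at \<pi> l C \<and> occurs_at \<pi> (Suc j) C}"])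
      show "?P {C. occurs_at \<pi> l C \<and> occurs_at \<pi> (Suc j) C} \<le> ?q ^ Suc d"
        if "l \<in> {i<..j}" for l
        unfolding d_def using that j by (intro prob_occurs_at_twice_le p \<pi>) auto
    qed (auto simp: avoids_upto_def not_le)
    also have "\<dots> \<le> ?k * ?q ^ Suc d"
      using i p by (intro mult_right_mono) auto
    finally show ?thesis .
  qed
  have indep: "?P (?U i \<inter> ?A (Suc j)) = f i * \<mu>"
  proof (cases "i = 0")
    case True
    thus ?thesis by (simp add: f_def avoids_upto_def \<mu>)
  next
    case False
    hence "i + ?k \<le> Suc j" by (simp add: i_def)
    thus ?thesis
      unfolding f_def using j by (subst prob_avoids_Int_occurs) (auto simp: \<mu>)
  qed
  have mono: "f j \<le> f i" "?P (?U j \<inter> ?A (Suc j)) \<le> ?P (?U i \<inter> ?A (Suc j))"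
    using i unfolding f_def
    by (auto intro!: measure_pmf.finite_measure_mono simp: avoids_upto_def)
  have "\<mu> * \<mu> \<le> ?q ^ d * ?q ^ d"
    using \<mu>_le p by (intro mult_mono) auto
  also have "\<dots> \<le> ?q ^ Suc d"
    unfolding power_add[symmetric] using p d by (intro power_decreasing) auto
  finally have sq: "\<mu> * \<mu> \<le> ?q ^ Suc d" .
  have "\<mu> * (f i - f j) \<le> \<mu> * (?k * \<mu>)"
    using window \<mu>_le unfolding f_def by (intro mult_left_mono) auto
  also have "\<dots> \<le> ?k * ?q ^ Suc d"
    using mult_left_mono[OF sq, of "real ?k"] by (simp add: mult.left_commute)
  finally have 1: "\<mu> * (f i - f j) \<le> ?k * ?q ^ Suc d" .
  have 2: "0 \<le> \<mu> * (f i - f j)"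
    using \<mu>_le mono by simp
  have "f (Suc j) - (1 - \<mu>) * f j
      = (?P (?U i \<inter> ?A (Suc j)) - ?P (?U j \<inter> ?A (Suc j))) - \<mu> * (f i - f j)"
    unfolding step indep by (simp add: algebra_simps)
  thus ?thesis
    using 1 2 clump mono(2) by linarith
qed

text \<open>
  Errors of the recurrence do not grow, since \<open>1 - \<mu> \<le> 1\<close>; they add up to \<open>j\<close> times one of them.
\<close>
lemma avoids_approx:
  fixes \<pi> :: "nat list" and n j :: nat and p :: real
  assumes \<pi>: "set \<pi> = {0..r}" "repeats \<pi> \<noteq> {}" and p: "0 \<le> p" "p < 1"
    and j: "j + length \<pi> \<le> n + 1"
  shows "\<bar>measure_pmf.prob (geom_composition n p) (avoids_upto \<pi> j) - (1 - occurrence_prob \<pi> r p) ^ j\<bar>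
      \<le> real j * (length \<pi> * (1 - p) ^ Suc (card (repeats \<pi>)))"
  using j
proof (induction j)
  case 0
  thus ?case by (simp add: avoids_upto_def)
next
  case (Suc j)
  let ?f = "\<lambda>j. measure_pmf.prob (geom_composition n p) (avoids_upto \<pi> j)"
  let ?\<mu> = "occurrence_prob \<pi> r p"
  let ?e = "length \<pi> * (1 - p) ^ Suc (card (repeats \<pi>))"
  have "?\<mu> = measure_pmf.prob (geom_composition n p) {C. occurs_at \<pi> 1 C}"
    using Suc.prems by (intro prob_occurs_at[symmetric] \<pi> p) auto
  hence \<mu>: "0 \<le> ?\<mu>" "?\<mu> \<le> 1" by auto
  have "?f (Suc j) - (1 - ?\<mu>) ^ Suc j
      = (?f (Suc j) - (1 - ?\<mu>) * ?f j) + (1 - ?\<mu>) * (?f j - (1 - ?\<mu>) ^ j)"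
    by (simp add: algebra_simps)
  also have "\<bar>\<dots>\<bar> \<le> \<bar>?f (Suc j) - (1 - ?\<mu>) * ?f j\<bar> + (1 - ?\<mu>) * \<bar>?f j - (1 - ?\<mu>) ^ j\<bar>"
    using \<mu> by (intro order_trans[OF abs_triangle_ineq]) (simp add: abs_mult)
  also have "\<dots> \<le> ?e + 1 * (real j * ?e)"
    using \<mu> Suc avoids_step[OF \<pi> p, of j n] p
    by (intro add_mono mult_mono) auto
  finally show ?case by (simp add: algebra_simps)
qed

text \<open>
  Only the disjoint windows starting at the multiples of \<open>length \<pi>\<close> are used, and these are independent.
\<close>
lemma avoids_le_power:
  assumes \<pi>: "set \<pi> = {0..r}" and p: "0 \<le> p" "p < 1" and j: "j * length \<pi> + length \<pi> \<le> n + 1"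
  shows "measure_pmf.prob (geom_composition n p) (avoids_upto \<pi> (j * length \<pi>))
       \<le> (1 - occurrence_prob \<pi> r p) ^ j"
  using j
proof (induction j)
  case (Suc j)
  let ?k = "length \<pi>" and ?\<mu> = "occurrence_prob \<pi> r p"
  let ?P = "measure_pmf.prob (geom_composition n p)"
  let ?A = "{C. occurs_at \<pi> (Suc j * ?k) C}" and ?U = "avoids_upto \<pi>"
  have "?k > 0" using \<pi> by auto
  hence l: "1 \<le> Suc j * ?k" by (simp add: Suc_le_eq)
  have \<mu>: "?P ?A = ?\<mu>"
    using Suc.prems l by (intro prob_occurs_at \<pi> p) auto
  hence \<mu>1: "?\<mu> \<le> 1" by (metis measure_pmf.prob_le_1)
  have "?U (Suc j * ?k) \<subseteq> ?U (j * ?k) - ?U (j * ?k) \<inter> ?A"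
    using l by (auto simp: avoids_upto_def)
  hence "?P (?U (Suc j * ?k)) \<le> ?P (?U (j * ?k) - ?U (j * ?k) \<inter> ?A)"
    by (intro measure_pmf.finite_measure_mono) auto
  also have "\<dots> = ?P (?U (j * ?k)) - ?P (?U (j * ?k) \<inter> ?A)"
    by (intro measure_pmf.finite_measure_Diff) auto
  also have "\<dots> = (1 - ?\<mu>) * ?P (?U (j * ?k))"
    using prob_avoids_Int_occurs[of "j * ?k" \<pi> "Suc j * ?k" n p] Suc.prems l
    unfolding \<mu> by (simp add: algebra_simps)
  also have "\<dots> \<le> (1 - ?\<mu>) * (1 - ?\<mu>) ^ j"
    using Suc \<mu>1 by (intro mult_left_mono) auto
  finally show ?case by simp
qed simp

lemma prob_contains_pattern:
  "measure_pmf.prob (geom_composition n p) {C. contains_pattern n C \<pi>}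
     = 1 - measure_pmf.prob (geom_composition n p) (avoids_upto \<pi> (n + 1 - length \<pi>))"
proof -
  have "{C. contains_pattern n C \<pi>} = UNIV - avoids_upto \<pi> (n + 1 - length \<pi>)"
    unfolding contains_pattern_def avoids_upto_def by (auto 0 3)
  thus ?thesis
    using measure_pmf.prob_compl[of "avoids_upto \<pi> (n + 1 - length \<pi>)" "geom_composition n p"]
    by simp
qed

section \<open>Limits\<close>

text \<open>
  Squeezed by powers of \<open>exp (- x / (1 - x)) \<le> 1 - x \<le> exp (- x)\<close>, valid for \<open>0 \<le> x < 1\<close>.
\<close>
lemma one_minus_power_tendsto_exp:
  fixes x :: "nat \<Rightarrow> real" and j :: "nat \<Rightarrow> nat"
  assumes "\<And>n. x n \<ge> 0" "x \<longlonglongrightarrow> 0" "(\<lambda>n. j n * x n) \<longlonglongrightarrow> t"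
  shows "(\<lambda>n. (1 - x n) ^ j n) \<longlonglongrightarrow> exp (- t)"
proof (rule tendsto_sandwich)
  have small: "\<forall>\<^sub>F n in sequentially. x n < 1"
    using assms(2) by (rule order_tendstoD) simp
  show "\<forall>\<^sub>F n in sequentially. exp (- (j n * x n / (1 - x n))) \<le> (1 - x n) ^ j n"
    using small
  proof eventually_elim
    case (elim n)
    have "1 / (1 - x n) = 1 + x n / (1 - x n)" using elim by (simp add: field_simps)
    also have "\<dots> \<le> exp (x n / (1 - x n))" by (rule exp_ge_add_one_self)
    finally have "exp (- (x n / (1 - x n))) \<le> 1 - x n"
      using elim by (simp add: exp_minus field_simps)
    hence "exp (- (x n / (1 - x n))) ^ j n \<le> (1 - x n) ^ j n"
      by (intro power_mono) auto
    thus ?case by (simp flip: exp_of_nat_mult)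
  qed
  show "\<forall>\<^sub>F n in sequentially. (1 - x n) ^ j n \<le> exp (- (j n * x n))"
    using small
  proof eventually_elim
    case (elim n)
    have "(1 - x n) ^ j n \<le> exp (- x n) ^ j n"
      using elim exp_ge_add_one_self[of "- x n"] by (intro power_mono) auto
    thus ?case by (simp flip: exp_of_nat_mult)
  qed
  show "(\<lambda>n. exp (- (j n * x n / (1 - x n)))) \<longlonglongrightarrow> exp (- t)"
    using tendsto_exp[OF tendsto_minus[OF tendsto_divide[OF assms(3)
            tendsto_diff[OF tendsto_const[of 1] assms(2)]]]] by simp
  show "(\<lambda>n. exp (- (j n * x n))) \<longlonglongrightarrow> exp (- t)"
    using assms(3) by (intro tendsto_intros)
qed

context
  fixes \<pi> :: "nat list" and r d :: nat and p q :: "nat \<Rightarrow> real"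
  assumes \<pi>: "set \<pi> = {0..r}" and d: "card (repeats \<pi>) = d" "d > 0"
    and p: "\<And>n. 0 \<le> p n" "\<And>n. p n < 1" and q: "\<And>n. q n = 1 - p n"
    and q_lim: "q \<longlonglongrightarrow> 0"
begin

lemma occurrence_prob_ratio_tendsto:
  "(\<lambda>n. occurrence_prob \<pi> r (p n) / q n ^ d) \<longlonglongrightarrow> 1 / (\<Prod>i\<le>r. real (level_count \<pi> i))"
proof -
  have "p \<longlonglongrightarrow> 1"
    using tendsto_diff[OF tendsto_const[of 1] q_lim] by (simp add: q)
  from occurrence_prob_asymp[OF \<pi> this p(2)] show ?thesis
    using d(1) \<pi> by (simp add: card_repeats q)
qed

lemma occurrence_prob_eq_ratio:
  "occurrence_prob \<pi> r (p n) = occurrence_prob \<pi> r (p n) / q n ^ d * q n ^ d"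
  using p(2)[of n] by (simp add: q)

lemma occurrence_prob_bounds: "0 \<le> occurrence_prob \<pi> r (p n)" "occurrence_prob \<pi> r (p n) \<le> 1"
proof -
  have "occurrence_prob \<pi> r (p n)
      = measure_pmf.prob (geom_composition (length \<pi>) (p n)) {C. occurs_at \<pi> 1 C}"
    by (intro prob_occurs_at[symmetric] \<pi> p) auto
  thus "0 \<le> occurrence_prob \<pi> r (p n)" "occurrence_prob \<pi> r (p n) \<le> 1" by auto
qed

text \<open>
  The error bound of \<open>avoids_approx\<close> is at most \<open>k (n q ^ d) q\<close>, which vanishes in the limit because
  of the spare factor \<open>q\<close>.
\<close>
lemma prob_contains_tendsto:
  assumes "(\<lambda>n. real n * q n ^ d) \<longlonglongrightarrow> \<tau>"
  shows "(\<lambda>n. measure_pmf.prob (geom_composition n (p n)) {C. contains_pattern n C \<pi>})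
           \<longlonglongrightarrow> 1 - exp (- (\<tau> / (\<Prod>i\<le>r. real (level_count \<pi> i))))"
proof -
  let ?k = "length \<pi>"
  define \<mu> where "\<mu> n = occurrence_prob \<pi> r (p n)" for n
  define j where "j n = n + 1 - ?k" for n
  define f where "f n = measure_pmf.prob (geom_composition n (p n)) (avoids_upto \<pi> (j n))" for n
  let ?lam = "\<Prod>i\<le>r. real (level_count \<pi> i)"
  have k: "?k > 0" using \<pi> by auto
  have ratio: "(\<lambda>n. \<mu> n / q n ^ d) \<longlonglongrightarrow> 1 / ?lam" and \<mu>_eq: "\<mu> n = \<mu> n / q n ^ d * q n ^ d" for n
    unfolding \<mu>_def using occurrence_prob_ratio_tendsto occurrence_prob_eq_ratio by auto
  have "(\<lambda>n. q n ^ d) \<longlonglongrightarrow> 0"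
    using tendsto_power[OF q_lim, of d] d by (simp add: power_0_left)
  from tendsto_mult[OF ratio this] have \<mu>0: "\<mu> \<longlonglongrightarrow> 0"
    unfolding mult_zero_right \<mu>_eq[symmetric] .
  have "(\<lambda>n. real n * \<mu> n) \<longlonglongrightarrow> \<tau> / ?lam"
    using tendsto_mult[OF assms ratio] p(2) by (simp add: q less_imp_neq)
  hence "(\<lambda>n. real n * \<mu> n - (real ?k - 1) * \<mu> n) \<longlonglongrightarrow> \<tau> / ?lam - (real ?k - 1) * 0"
    using \<mu>0 by (intro tendsto_intros)
  moreover have "\<forall>\<^sub>F n in sequentially. real n * \<mu> n - (real ?k - 1) * \<mu> n = j n * \<mu> n"
    using eventually_ge_at_top[of ?k]
    by eventually_elim (simp add: j_def of_nat_diff algebra_simps)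
  ultimately have j\<mu>: "(\<lambda>n. j n * \<mu> n) \<longlonglongrightarrow> \<tau> / ?lam"
    by (auto dest: Lim_transform_eventually)
  have main: "(\<lambda>n. (1 - \<mu> n) ^ j n) \<longlonglongrightarrow> exp (- (\<tau> / ?lam))"
    by (intro one_minus_power_tendsto_exp \<mu>0 j\<mu>) (simp add: \<mu>_def occurrence_prob_bounds)
  have err: "(\<lambda>n. real ?k * (real n * q n ^ d) * q n) \<longlonglongrightarrow> 0"
    using tendsto_mult[OF tendsto_mult[OF tendsto_const[of "real ?k"] assms] q_lim] by simp
  have "\<forall>\<^sub>F n in sequentially. norm (f n - (1 - \<mu> n) ^ j n) \<le> real ?k * (real n * q n ^ d) * q n"
    using eventually_ge_at_top[of ?k]
  proof eventually_elim
    case (elim n)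
    have "\<bar>f n - (1 - \<mu> n) ^ j n\<bar> \<le> real (j n) * (real ?k * (1 - p n) ^ Suc (card (repeats \<pi>)))"
      unfolding f_def \<mu>_def using elim p d by (intro avoids_approx \<pi>) (auto simp: j_def)
    also have "\<dots> \<le> real n * (real ?k * (1 - p n) ^ Suc (card (repeats \<pi>)))"
    proof (rule mult_right_mono)
      show "real (j n) \<le> real n" using k unfolding j_def by linarith
    qed (use p(2)[of n] in simp)
    finally show ?case by (simp add: d q mult_ac)
  qed
  from Lim_null_comparison[OF this err] have "(\<lambda>n. f n - (1 - \<mu> n) ^ j n) \<longlonglongrightarrow> 0" .
  from tendsto_add[OF this main] have "f \<longlonglongrightarrow> exp (- (\<tau> / ?lam))" by simp
  thus ?thesis
    unfolding prob_contains_pattern j_def[symmetric] f_def[symmetric] by (intro tendsto_intros)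
qed

text \<open>
  In this regime the error bound of \<open>avoids_approx\<close> may diverge; independent windows give an upper
  bound without an error term.
\<close>
lemma prob_contains_tendsto_1:
  assumes "filterlim (\<lambda>n. real n * q n ^ d) at_top sequentially"
  shows "(\<lambda>n. measure_pmf.prob (geom_composition n (p n)) {C. contains_pattern n C \<pi>})
           \<longlonglongrightarrow> 1"
proof -
  let ?k = "length \<pi>" and ?lam = "\<Prod>i\<le>r. real (level_count \<pi> i)"
  define \<mu> where "\<mu> n = occurrence_prob \<pi> r (p n)" for n
  define f where "f n = measure_pmf.prob (geom_composition n (p n)) (avoids_upto \<pi> (n + 1 - ?k))" for n
  have k: "?k > 0" using \<pi> by auto
  have \<mu>: "0 \<le> \<mu> n" "\<mu> n \<le> 1" for n
    unfolding \<mu>_def by (fact occurrence_prob_bounds)+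
  have "?lam > 0"
    using level_count_pos[OF \<pi>] by (intro prod_pos) auto
  hence "filterlim (\<lambda>n. \<mu> n / q n ^ d * (real n * q n ^ d)) at_top sequentially"
    unfolding \<mu>_def using assms
    by (intro filterlim_tendsto_pos_mult_at_top[OF occurrence_prob_ratio_tendsto]) auto
  moreover have "\<mu> n / q n ^ d * (real n * q n ^ d) = real n * \<mu> n" for n
    using p(2)[of n] by (simp add: q)
  ultimately have "filterlim (\<lambda>n. real n * \<mu> n) at_top sequentially"
    by simp
  hence "filterlim (\<lambda>n. - 2 + (1 / ?k) * (real n * \<mu> n)) at_top sequentially"
    using k by (intro filterlim_tendsto_add_at_top[OF tendsto_const]
                      filterlim_tendsto_pos_mult_at_top[OF tendsto_const]) auto
  hence lim: "(\<lambda>n. exp (- (- 2 + (1 / ?k) * (real n * \<mu> n)))) \<longlonglongrightarrow> 0"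
    by (intro filterlim_compose[OF exp_at_bot]) (simp only: filterlim_uminus_at_bot minus_minus)
  have "f n \<le> exp (- (- 2 + (1 / ?k) * (real n * \<mu> n)))" if n: "n \<ge> ?k" for n
  proof -
    define j where "j = (n + 1 - ?k) div ?k"
    have j: "j * ?k \<le> n + 1 - ?k" by (simp add: j_def)
    \<comment> \<open>Both roundings together lose fewer than \<open>2 k\<close> positions.\<close>
    have "real n \<le> real (j * ?k + 2 * ?k)"
    proof -
      have "n + 1 - ?k < j * ?k + ?k"
        using k by (metis j_def dividend_less_times_div mult.commute add.commute mult_Suc_right)
      thus ?thesis by linarith
    qed
    hence "real n / ?k \<le> j + 2"
      using k by (simp add: field_simps)
    hence "real n / ?k * \<mu> n \<le> (j + 2) * \<mu> n"
      using \<mu> by (intro mult_right_mono) auto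
    hence j\<mu>: "real n / ?k * \<mu> n \<le> j * \<mu> n + 2"
      using \<mu>(2)[of n] by (simp add: algebra_simps)
    have "f n \<le> measure_pmf.prob (geom_composition n (p n)) (avoids_upto \<pi> (j * ?k))"
      unfolding f_def using j
      by (intro measure_pmf.finite_measure_mono) (auto simp: avoids_upto_def)
    also have "\<dots> \<le> (1 - \<mu> n) ^ j"
      unfolding \<mu>_def using j n by (intro avoids_le_power \<pi> p) auto
    also have "\<dots> \<le> exp (- \<mu> n) ^ j"
      using \<mu>(2)[of n] exp_ge_add_one_self[of "- \<mu> n"] by (intro power_mono) auto
    also have "\<dots> = exp (- (j * \<mu> n))"
      by (simp flip: exp_of_nat_mult)
    also have "\<dots> \<le> exp (- (- 2 + (1 / ?k) * (real n * \<mu> n)))"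
      using j\<mu> by simp
    finally show ?thesis .
  qed
  hence "f \<longlonglongrightarrow> 0"
    by (intro tendsto_sandwich[OF _ _ tendsto_const lim])
       (auto simp: f_def eventually_at_top_linorder)
  thus ?thesis
    unfolding prob_contains_pattern f_def[symmetric]
    using tendsto_diff[OF tendsto_const[of 1]] by fastforce
qed

end

lemma level_count_eq_sum:
  assumes "set \<pi> = {0..r}" "j \<le> r"
  shows "level_count \<pi> j = (\<Sum>i\<in>{j..r}. count (mset \<pi>) i)"
proof -
  let ?M = "filter_mset (\<lambda>v. j \<le> v) (mset \<pi>)"
  have "level_count \<pi> j = size ?M"
    by (simp add: level_count_def length_filter_conv_card flip: mset_filter)
  also have "\<dots> = (\<Sum>i\<in>set_mset ?M. count ?M i)"
    by (rule size_multiset_overloaded_eq)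
  also have "set_mset ?M = {j..r}" using assms by auto
  also have "(\<Sum>i\<in>{j..r}. count ?M i) = (\<Sum>i\<in>{j..r}. count (mset \<pi>) i)"
    by simp
  finally show ?thesis .
qed

theorem proposition4p20:
  fixes \<pi> :: "nat list" and r k d :: nat and m :: "nat \<Rightarrow> nat"
    and p q P :: "nat \<Rightarrow> real" and \<alpha> lam :: real
  assumes pattern: "ordering_pattern \<pi>"
    and terms: "mset \<pi> = (\<Sum>j\<in>{0..r}. replicate_mset (m j) j)"
    and mult_pos: "\<forall>j\<in>{0..r}. m j \<ge> 1"
    and repeated: "\<exists>j\<in>{0..r}. m j > 1"
    and k: "k = length \<pi>"
    and d: "d = k - (r + 1)"
    and lam: "lam = real (\<Prod>j\<in>{0..r}. \<Sum>i\<in>{j..r}. m i)"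
    and p: "\<forall>n. 0 \<le> p n \<and> p n < 1"
    and q: "\<forall>n. q n = 1 - p n"
    and alpha: "\<alpha> > 0"
    and P: "\<forall>n. P n = measure_pmf.prob (geom_composition n (p n)) {C. contains_pattern n C \<pi>}"
  shows "(q \<in> o(\<lambda>n. 1) \<and> (\<lambda>n. real n powr (- 1 / real d)) \<in> o(q) \<longrightarrow> P \<longlonglongrightarrow> 1) \<and>
         (q \<sim>[at_top] (\<lambda>n. \<alpha> * real n powr (- 1 / real d)) \<longrightarrow>
            P \<longlonglongrightarrow> 1 - exp (- (\<alpha> ^ d / lam))) \<and>
         (q \<in> o(\<lambda>n. real n powr (- 1 / real d)) \<longrightarrow> P \<longlonglongrightarrow> 0)"
proof -
  let ?g = "\<lambda>n. real n powr (- 1 / real d)"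
  have count: "count (mset \<pi>) i = (if i \<le> r then m i else 0)" for i
    unfolding terms by (simp add: count_sum)
  have "i \<in> set \<pi> \<longleftrightarrow> i \<le> r" for i
  proof -
    have "i \<in> set \<pi> \<longleftrightarrow> 0 < count (mset \<pi>) i" by simp
    also have "\<dots> \<longleftrightarrow> i \<le> r" unfolding count using mult_pos by force
    finally show ?thesis .
  qed
  hence \<pi>: "set \<pi> = {0..r}" by (simp only: set_eq_iff atLeastAtMost_iff le0 simp_thms)
  have level: "level_count \<pi> j = (\<Sum>i\<in>{j..r}. m i)" if "j \<le> r" for j
    by (simp add: level_count_eq_sum[OF \<pi> that] count)
  have lam': "lam = (\<Prod>i\<le>r. real (level_count \<pi> i))"
    unfolding lam by (simp add: level atLeast0AtMost)
  have "r + 1 = (\<Sum>i\<in>{0..r}. 1)" by simp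
  also have "\<dots> < (\<Sum>i\<in>{0..r}. m i)"
    using mult_pos repeated by (intro sum_strict_mono_ex1) auto
  also have "\<dots> = k"
    using level[of 0] by (simp add: level_count_def k)
  finally have d_pos: "d > 0" by (simp add: d)
  have card: "card (repeats \<pi>) = d"
    using \<pi> by (simp add: card_repeats d k)
  have q_pos: "q n > 0" for n using p q by simp
  have p': "0 \<le> p n" "p n < 1" and q': "q n = 1 - p n" for n
    using p q by auto
  have P_eq: "P = (\<lambda>n. measure_pmf.prob (geom_composition n (p n)) {C. contains_pattern n C \<pi>})"
    using P by auto
  \<comment> \<open>Turns a comparison of \<open>q\<close> with \<open>n powr (- 1 / d)\<close> into a limit of \<open>n q ^ d\<close>.\<close>
  have scale: "real n * q n ^ d = (q n / ?g n) ^ d" if "n > 0" for n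
  proof -
    have "?g n ^ d = real n powr (real d * (- 1 / real d))"
      using that by (simp add: powr_powr flip: powr_realpow)
    also have "\<dots> = inverse (real n)"
      using that d_pos by (simp add: powr_minus)
    finally show ?thesis by (simp add: power_divide field_simps)
  qed
  have scale_lim: "filterlim (\<lambda>n. real n * q n ^ d) F sequentially
      \<longleftrightarrow> filterlim (\<lambda>n. (q n / ?g n) ^ d) F sequentially" for F
    by (intro filterlim_cong refl eventually_mono[OF eventually_gt_at_top[of 0]] scale)
  have g_lim: "?g \<longlonglongrightarrow> 0"
    using d_pos by (intro tendsto_neg_powr filterlim_real_sequentially) auto
  have limit: "P \<longlonglongrightarrow> 1 - exp (- (\<beta> ^ d / lam))" if *: "(\<lambda>n. q n / ?g n) \<longlonglongrightarrow> \<beta>" for \<beta>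
  proof -
    have "(\<lambda>n. q n / ?g n * ?g n) \<longlonglongrightarrow> \<beta> * 0"
      using * g_lim by (intro tendsto_mult)
    moreover have "\<forall>\<^sub>F n in sequentially. q n / ?g n * ?g n = q n"
      using eventually_gt_at_top[of 0] by eventually_elim simp
    ultimately have "q \<longlonglongrightarrow> 0"
      by (auto dest: Lim_transform_eventually)
    moreover have "(\<lambda>n. real n * q n ^ d) \<longlonglongrightarrow> \<beta> ^ d"
      unfolding scale_lim using * by (intro tendsto_power)
    ultimately show ?thesis
      unfolding P_eq lam' by (rule prob_contains_tendsto[OF \<pi> card d_pos p' q'])
  qed
  show ?thesis
  proof (intro conjI impI)
    assume *: "q \<in> o(\<lambda>n. 1) \<and> ?g \<in> o(q)"
    have "(\<lambda>n. ?g n / q n) \<longlonglongrightarrow> 0"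
      using * by (intro smalloD_tendsto) auto
    hence "filterlim (\<lambda>n. inverse (?g n / q n)) at_top sequentially"
      using q_pos by (intro filterlim_inverse_at_top)
        (auto intro!: eventually_mono[OF eventually_gt_at_top[of 0]])
    hence "filterlim (\<lambda>n. q n / ?g n) at_top sequentially"
      by (simp add: field_simps)
    hence "filterlim (\<lambda>n. real n * q n ^ d) at_top sequentially"
      unfolding scale_lim using d_pos by (intro filterlim_pow_at_top)
    moreover from * have "q \<longlonglongrightarrow> 0"
      using smalloD_tendsto[of q _ "\<lambda>_. 1"] by simp
    ultimately show "P \<longlonglongrightarrow> 1"
      unfolding P_eq by (intro prob_contains_tendsto_1[OF \<pi> card d_pos p' q'])
  next
    assume *: "q \<sim>[at_top] (\<lambda>n. \<alpha> * ?g n)"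
    have "(\<lambda>n. q n / (\<alpha> * ?g n)) \<longlonglongrightarrow> 1"
      using q_pos by (intro asymp_equivD_strong[OF *]) (auto simp: less_imp_neq[symmetric])
    hence "(\<lambda>n. \<alpha> * (q n / (\<alpha> * ?g n))) \<longlonglongrightarrow> \<alpha> * 1"
      by (intro tendsto_mult tendsto_const)
    thus "P \<longlonglongrightarrow> 1 - exp (- (\<alpha> ^ d / lam))"
      using alpha by (intro limit) simp
  next
    assume "q \<in> o(?g)"
    hence "(\<lambda>n. q n / ?g n) \<longlonglongrightarrow> 0"
      by (rule smalloD_tendsto)
    from limit[OF this] show "P \<longlonglongrightarrow> 0"
      using d_pos by (simp add: power_0_left)
  qed
qed

end
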